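(* Let $a,b\in\mathbb{R}$ with $a<b$, and let $n\in\mathbb{N}$, $n\ge 2$. Then for all $\alpha,\lambda\in[0,1]$, $q>1$, and $p$ with $\frac1p+\frac1q=1$, $$\left|\lambda A_\alpha(a^n,b^n)+(1-\lambda)A_\alpha^n(a,b)-L_n^n(a,b)\right|$$ $$\le (b-a)\left(\frac{1}{p+1}\right)^{1/p}n\cdot\begin{cases}(1-\alpha)^{1/q}F^{1/q}\varepsilon_1^{1/p}+\alpha^{1/q}G^{1/q}\varepsilon_3^{1/p}, & \alpha\lambda\le 1-\alpha\le 1-\lambda(1-\alpha),\\ (1-\alpha)^{1/q}F^{1/q}\varepsilon_1^{1/p}+\alpha^{1/q}G^{1/q}\varepsilon_4^{1/p}, & \alpha\lambda\le 1-\lambda(1-\alpha)\le 1-\alpha,\\ (1-\alpha)^{1/q}F^{1/q}\varepsilon_2^{1/p}+\alpha^{1/q}G^{1/q}\varepsilon_3^{1/p}, & 1-\alpha\le\alpha\lambda\le 1-\lambda(1-\alpha),\end{cases}$$ where $$F=\sup\{|a|^{(n-1)q},|A_\alpha(a,b)|^{(n-1)q}\},\qquad G=\sup\{|b|^{(n-1)q},|A_\alpha(a,b)|^{(n-1)q}\},$$ $$\varepsilon_1=(\alpha\lambda)^{p+1}+(1-\alpha-\alpha\lambda)^{p+1},\qquad \varepsilon_2=(\alpha\lambda)^{p+1}-(\alpha\lambda-1+\alpha)^{p+1},$$ $$\varepsilon_3=[\lambda(1-\alpha)]^{p+1}+[\alpha-\lambda(1-\alpha)]^{p+1},\qquad 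\varepsilon_4=[\lambda(1-\alpha)]^{p+1}-[\lambda(1-\alpha)-\alpha]^{p+1}.$$
   Context: Weighted arithmetic mean: $A_\alpha(x,y)=\alpha x+(1-\alpha)y$ for $x,y\in\mathbb{R}$; $A_\alpha^n(a,b)=(A_\alpha(a,b))^n$. $n$-logarithmic mean: $L_n(a,b)=\left(\frac{b^{n+1}-a^{n+1}}{(n+1)(b-a)}\right)^{1/n}$ for $a\ne b$, so that $L_n^n(a,b)=(L_n(a,b))^n=\frac{b^{n+1}-a^{n+1}}{(n+1)(b-a)}$. Each $\varepsilon_i$ is only used in the cases where the bases of its powers are nonnegative. *)

theory Defs
  imports Complex_Main
begin

definition wmean :: "real \<Rightarrow> real \<Rightarrow> real \<Rightarrow> real"
  where "wmean \<alpha> x y = \<alpha> * x + (1 - \<alpha>) * y"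

text \<open>The \<open>n\<close>-logarithmic mean, for \<open>a \<noteq> b\<close>. The quotient can be negative when \<open>n\<close> is odd;
  \<^const>\<open>root\<close> is the signed real root for odd \<open>n\<close>, whereas \<open>powr\<close> is not meaningful there.
  For \<open>n\<close> even and positive the quotient is nonnegative.\<close>

definition log_mean :: "nat \<Rightarrow> real \<Rightarrow> real \<Rightarrow> real"
  where "log_mean n a b = root n ((b ^ (n + 1) - a ^ (n + 1)) / ((real n + 1) * (b - a)))"

lemma log_mean_power:
  assumes "a < b" and "n \<ge> 1"
  shows "(log_mean n a b) ^ n = (b ^ (n + 1) - a ^ (n + 1)) / ((real n + 1) * (b - a))"
proof (cases "odd n")
  case True
  then show ?thesis
    unfolding log_mean_def by (rule odd_real_root_pow)
next
  case False
  have "a ^ (n + 1) \<le> b ^ (n + 1)"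
    using assms False by (intro power_mono_odd) auto
  then have "0 \<le> (b ^ (n + 1) - a ^ (n + 1)) / ((real n + 1) * (b - a))"
    using assms by simp
  then show ?thesis
    unfolding log_mean_def using assms by (intro real_root_pow_pos2) auto
qed

definition F_sup :: "nat \<Rightarrow> real \<Rightarrow> real \<Rightarrow> real \<Rightarrow> real \<Rightarrow> real"
  where "F_sup n q \<alpha> a b =
    Sup {\<bar>a\<bar> powr ((real n - 1) * q), \<bar>wmean \<alpha> a b\<bar> powr ((real n - 1) * q)}"

definition G_sup :: "nat \<Rightarrow> real \<Rightarrow> real \<Rightarrow> real \<Rightarrow> real \<Rightarrow> real"
  where "G_sup n q \<alpha> a b =
    Sup {\<bar>b\<bar> powr ((real n - 1) * q), \<bar>wmean \<alpha> a b\<bar> powr ((real n - 1) * q)}"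

text \<open>Each of the following is meant only for parameters making all bases of \<open>powr\<close> nonnegative.\<close>

definition eps1 :: "real \<Rightarrow> real \<Rightarrow> real \<Rightarrow> real"
  where "eps1 p \<alpha> lam = (\<alpha> * lam) powr (p + 1) + (1 - \<alpha> - \<alpha> * lam) powr (p + 1)"

definition eps2 :: "real \<Rightarrow> real \<Rightarrow> real \<Rightarrow> real"
  where "eps2 p \<alpha> lam = (\<alpha> * lam) powr (p + 1) - (\<alpha> * lam - 1 + \<alpha>) powr (p + 1)"

definition eps3 :: "real \<Rightarrow> real \<Rightarrow> real \<Rightarrow> real"
  where "eps3 p \<alpha> lam = (lam * (1 - \<alpha>)) powr (p + 1) + (\<alpha> - lam * (1 - \<alpha>)) powr (p + 1)"

definition eps4 :: "real \<Rightarrow> real \<Rightarrow> real \<Rightarrow> real"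
  where "eps4 p \<alpha> lam = (lam * (1 - \<alpha>)) powr (p + 1) - (lam * (1 - \<alpha>) - \<alpha>) powr (p + 1)"

end

theory Submission
  imports Defs "HOL-Analysis.Convex"
begin

text \<open>Let \<open>c = wmean \<alpha> a b\<close> and let \<open>x t = t b + (1 - t) a\<close>, so that \<open>x (1 - \<alpha>) = c\<close>. For each pivot \<open>s\<close>
  the function \<open>g t = (t - s) (x t)\<^sup>n - (x t)\<^sup>n\<^sup>+\<^sup>1 / ((n + 1) (b - a))\<close> satisfies
  \<open>g' t = (t - s) (b - a) n (x t)\<^sup>n\<^sup>-\<^sup>1\<close>, and the expression to be estimated is the sum of the increments
  of \<open>g\<close> over \<open>[0, 1 - \<alpha>]\<close> with \<open>s = \<alpha> \<lambda>\<close> and over \<open>[1 - \<alpha>, 1]\<close> with \<open>s = 1 - \<lambda> (1 - \<alpha>)\<close>. On each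
  interval \<open>\<bar>x t\<bar>\<close> is bounded by its value at an endpoint, and Hoelder's inequality controls
  \<open>\<integral> \<bar>t - s\<bar> dt\<close> by \<open>\<integral> \<bar>t - s\<bar>\<^sup>p dt\<close>. The three cases of the theorem differ only in the signs of
  \<open>t - s\<close> at the endpoints.\<close>

text \<open>Oddness reduces negative points to positive ones. At \<open>0\<close> the difference
  quotient is \<open>\<bar>z\<bar> powr p\<close> itself, which is continuous there since
  \<open>p > 0\<close>, so Caratheodory's criterion applies.\<close>

lemma DERIV_mult_abs_powr:
  fixes p x :: real
  assumes "p > 0"
  shows "((\<lambda>x. x * \<bar>x\<bar> powr p) has_real_derivative (p + 1) * \<bar>x\<bar> powr p) (at x)"
proof -
  have pos: "((\<lambda>x. x * \<bar>x\<bar> powr p) has_real_derivative (p + 1) * \<bar>y\<bar> powr p) (at y)"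
    if "y > 0" for y :: real
  proof (rule has_field_derivative_transform_within_open)
    show "((\<lambda>x. x * x powr p) has_real_derivative (p + 1) * \<bar>y\<bar> powr p) (at y)"
      using that by (auto intro!: derivative_eq_intros simp: powr_diff algebra_simps)
  qed (use that in \<open>auto intro: open_greaterThan\<close>)
  consider "x = 0" | "x > 0" | "x < 0" by linarith
  then show ?thesis
  proof cases
    case 1
    have "isCont (\<lambda>z::real. \<bar>z\<bar> powr p) 0"
      unfolding isCont_def by (rule tendsto_powr') (use assms in \<open>auto intro!: tendsto_eq_intros\<close>)
    then show ?thesis
      unfolding CARAT_DERIV using 1 assms by (intro exI[of _ "\<lambda>z. \<bar>z\<bar> powr p"]) auto
  next
    case 2
    then show ?thesis by (rule pos)
  next
    case 3
    then show ?thesis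
      using DERIV_minus[OF DERIV_mirror[THEN iffD1, OF pos[of "- x"]]] by simp
  qed
qed

text \<open>Makes the integral of \<open>\<bar>t - s\<bar> powr p\<close> over a nondegenerate
  interval positive, so that the Young parameter built from it is positive.\<close>

lemma mult_abs_powr_strict_mono:
  fixes p x y :: real
  assumes "p > 0" "x < y"
  shows "x * \<bar>x\<bar> powr p < y * \<bar>y\<bar> powr p"
proof -
  have pos: "u * \<bar>u\<bar> powr p < v * \<bar>v\<bar> powr p" if "0 \<le> u" "u < v" for u v :: real
    using that assms(1) by (auto intro!: mult_strict_mono powr_less_mono2)
  consider "0 \<le> x" | "y \<le> 0" | "x < 0" "0 < y" by linarith
  then show ?thesis
  proof cases
    case 1
    then show ?thesis using pos assms(2) by blast
  next
    case 2
    then show ?thesis using pos[of "- y" "- x"] assms(2) by simp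
  next
    case 3
    then have "x * \<bar>x\<bar> powr p < 0" "0 < y * \<bar>y\<bar> powr p"
      by (auto simp: mult_neg_pos)
    then show ?thesis by linarith
  qed
qed

text \<open>A form of Hoelder's inequality: \<open>(x * \<bar>x\<bar> powr p) / (p + 1)\<close> is an antiderivative of \<open>\<bar>x\<bar> powr p\<close>,
  so the last factor is the \<open>L\<^sup>p\<close> norm of \<open>t - s\<close> on \<open>[l, r]\<close>, up to a constant. No integral
  is needed: Young's inequality for \<open>\<bar>t - s\<bar>\<close> and a constant \<open>m\<close> bounds \<open>m * \<bar>g' t\<bar>\<close> by the derivative of
  an explicit function \<open>H\<close>, and \<open>m\<close> is the value for which the resulting bound is optimal.\<close>

lemma increment_bound:
  fixes g g' :: "real \<Rightarrow> real" and l r s M p q :: real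
  assumes "l \<le> r" "M \<ge> 0" and pq: "p > 1" "q > 1" "1 / p + 1 / q = 1"
    and deriv: "\<And>t. l \<le> t \<Longrightarrow> t \<le> r \<Longrightarrow> (g has_real_derivative g' t) (at t)"
    and bound: "\<And>t. l \<le> t \<Longrightarrow> t \<le> r \<Longrightarrow> \<bar>g' t\<bar> \<le> M * \<bar>t - s\<bar>"
  shows "\<bar>g r - g l\<bar> \<le> M * (1 / (p + 1)) powr (1 / p) * (r - l) powr (1 / q) *
    ((r - s) * \<bar>r - s\<bar> powr p - (l - s) * \<bar>l - s\<bar> powr p) powr (1 / p)"
proof (cases "l = r")
  case False
  with assms have lr: "l < r" by simp
  define I where "I = ((r - s) * \<bar>r - s\<bar> powr p - (l - s) * \<bar>l - s\<bar> powr p) / (p + 1)"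
  have I: "I > 0"
    using mult_abs_powr_strict_mono[of p "l - s" "r - s"] lr pq by (simp add: I_def)
  \<comment> \<open>With this \<open>m\<close> the two Young terms contribute \<open>I / p\<close>
    and \<open>I / q\<close>, which add up to \<open>I\<close>.\<close>
  define m where "m = (I / (r - l)) powr (1 / q)"
  have m: "m > 0" and mq: "(r - l) * m powr q = I"
    using I lr pq by (auto simp: m_def powr_powr)
  define P where "P = (\<lambda>t. (t - s) * \<bar>t - s\<bar> powr p / (p + 1))"
  have I_P: "I = P r - P l"
    by (simp add: I_def P_def diff_divide_distrib)
  define H where "H t = M * (P t / p + t * (m powr q / q))" for t
  define H' where "H' t = M * (\<bar>t - s\<bar> powr p / p + m powr q / q)" for t
  have "((\<lambda>t. (t - s) * \<bar>t - s\<bar> powr p) has_real_derivative (p + 1) * \<bar>t - s\<bar> powr p) (at t)" for t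
    using DERIV_shift[of "\<lambda>x. x * \<bar>x\<bar> powr p" _ t "- s"] DERIV_mult_abs_powr[of p "t - s"] pq by simp
  from DERIV_cdivide[OF this, of "p + 1"]
  have P: "(P has_real_derivative \<bar>t - s\<bar> powr p) (at t)" for t
    using pq by (simp add: P_def)
  have H: "(H has_real_derivative H' t) (at t)" for t
    unfolding H_def H'_def
    using DERIV_cmult[OF DERIV_add[OF DERIV_cdivide[OF P] DERIV_cmult_right[OF DERIV_ident]]]
    by (simp del: times_divide_eq_right)
  have young: "m * \<bar>g' t\<bar> \<le> H' t" if "l \<le> t" "t \<le> r" for t
  proof -
    have "m * \<bar>g' t\<bar> \<le> M * (\<bar>t - s\<bar> * m)"
      using bound[OF that] m by (simp add: mult.commute mult.left_commute)
    also have "\<dots> \<le> H' t"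
      unfolding H'_def using Youngs_inequality[OF pq, of "\<bar>t - s\<bar>" m] assms(2) m
      by (intro mult_left_mono) auto
    finally show ?thesis .
  qed
  \<comment> \<open>Monotonicity of \<open>H + m g\<close> and of \<open>H - m g\<close> together
    gives the absolute value.\<close>
  have incr: "H l + \<sigma> * m * g l \<le> H r + \<sigma> * m * g r" if "\<sigma> = 1 \<or> \<sigma> = - 1" for \<sigma>
  proof (rule DERIV_nonneg_imp_nondecreasing[OF assms(1)])
    fix t assume t: "l \<le> t" "t \<le> r"
    have "((\<lambda>t. H t + \<sigma> * m * g t) has_real_derivative H' t + \<sigma> * m * g' t) (at t)"
      by (intro DERIV_add H DERIV_cmult deriv t)
    moreover have "\<bar>\<sigma> * m * g' t\<bar> \<le> H' t"
      using young[OF t] m that by (auto simp: abs_mult)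
    ultimately show "\<exists>y. ((\<lambda>t. H t + \<sigma> * m * g t) has_real_derivative y) (at t) \<and> y \<ge> 0"
      by (intro exI[of _ "H' t + \<sigma> * m * g' t"]) auto
  qed
  have "m * \<bar>g r - g l\<bar> = \<bar>m * g r - m * g l\<bar>"
    using m by (simp add: abs_mult flip: right_diff_distrib)
  also have "\<dots> \<le> H r - H l"
    using incr[of 1] incr[of "- 1"] by (simp add: abs_le_iff)
  also have "H r - H l = M * (I / p + (r - l) * m powr q / q)"
    by (simp add: H_def I_P diff_divide_distrib algebra_simps)
  also have "\<dots> = M * (I * (1 / p + 1 / q))"
    by (simp add: mq distrib_left)
  also have "\<dots> = M * I"
    using pq by simp
  finally have "\<bar>g r - g l\<bar> \<le> M * (I / m)"
    using m by (simp add: field_simps)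
  also have "I / m = (r - l) powr (1 / q) * I powr (1 / p)"
  proof -
    have "I powr (1 / q) * I powr (1 / p) = I"
      using I pq by (simp add: add.commute flip: powr_add)
    then show ?thesis
      using I lr by (simp add: m_def powr_divide field_simps)
  qed
  finally show ?thesis
    by (simp add: I_def powr_divide mult_ac)
qed simp

lemma abs_power_le_Sup_powr:
  fixes u v x q :: real
  assumes "n \<ge> 2" "q > 0" "\<bar>x\<bar> \<le> max \<bar>u\<bar> \<bar>v\<bar>"
  shows "\<bar>x\<bar> ^ (n - 1) \<le> Sup {\<bar>u\<bar> powr ((real n - 1) * q), \<bar>v\<bar> powr ((real n - 1) * q)} powr (1 / q)"
proof -
  let ?e = "(real n - 1) * q"
  \<comment> \<open>At \<open>x = 0\<close> this relies on \<open>n - 1 > 0\<close>: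
    \<open>0 ^ 0\<close> is 1, but \<open>0 powr 0\<close> is 0.\<close>
  have "\<bar>x\<bar> ^ (n - 1) = \<bar>x\<bar> powr (real n - 1)"
    using assms(1) by (cases "x = 0") (auto simp: powr_realpow[symmetric] of_nat_diff)
  also have "\<dots> = (\<bar>x\<bar> powr ?e) powr (1 / q)"
    using assms(2) by (simp add: powr_powr)
  also have "\<dots> \<le> Sup {\<bar>u\<bar> powr ?e, \<bar>v\<bar> powr ?e} powr (1 / q)"
  proof (rule powr_mono2)
    have "\<bar>x\<bar> powr ?e \<le> max \<bar>u\<bar> \<bar>v\<bar> powr ?e"
      using assms by (intro powr_mono2) auto
    also have "\<dots> \<le> max (\<bar>u\<bar> powr ?e) (\<bar>v\<bar> powr ?e)"
      by (simp add: max_def)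
    also have "\<dots> = Sup {\<bar>u\<bar> powr ?e, \<bar>v\<bar> powr ?e}"
      by (simp add: cSup_eq_Max)
    finally show "\<bar>x\<bar> powr ?e \<le> Sup {\<bar>u\<bar> powr ?e, \<bar>v\<bar> powr ?e}" .
  qed (use assms in auto)
  finally show ?thesis .
qed

lemma abs_affine_le_max:
  fixes a b l r t :: real
  assumes "a \<le> b" "l \<le> t" "t \<le> r"
  shows "\<bar>t * b + (1 - t) * a\<bar> \<le> max \<bar>l * b + (1 - l) * a\<bar> \<bar>r * b + (1 - r) * a\<bar>"
proof -
  have "l * (b - a) \<le> t * (b - a)" "t * (b - a) \<le> r * (b - a)"
    using assms by (auto intro: mult_right_mono)
  then show ?thesis
    by (simp add: algebra_simps max_def abs_if)
qed

text \<open>Instance of \<open>increment_bound\<close> with \<open>M = (b - a) * real n * S\<close>: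
  since \<open>x\<close> is monotone, \<open>\<bar>x t\<bar>\<close> is at most its larger endpoint
  value, and the outer power \<open>1 / q\<close> undoes the \<open>q\<close> in the
  exponents.\<close>

lemma segment_bound:
  fixes a b l r s p q :: real and n :: nat
  defines "x \<equiv> \<lambda>t. t * b + (1 - t) * a"
  defines "g \<equiv> \<lambda>t. (t - s) * x t ^ n - x t ^ (n + 1) / ((real n + 1) * (b - a))"
  assumes "a < b" "n \<ge> 2" "l \<le> r" and pq: "p > 1" "q > 1" "1 / p + 1 / q = 1"
  shows "\<bar>g r - g l\<bar> \<le> (b - a) * (1 / (p + 1)) powr (1 / p) * real n * ((r - l) powr (1 / q) *
    Sup {\<bar>x l\<bar> powr ((real n - 1) * q), \<bar>x r\<bar> powr ((real n - 1) * q)} powr (1 / q) *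
    ((r - s) * \<bar>r - s\<bar> powr p - (l - s) * \<bar>l - s\<bar> powr p) powr (1 / p))"
proof -
  define S where "S = Sup {\<bar>x l\<bar> powr ((real n - 1) * q), \<bar>x r\<bar> powr ((real n - 1) * q)} powr (1 / q)"
  have "\<bar>g r - g l\<bar> \<le> ((b - a) * real n * S) * (1 / (p + 1)) powr (1 / p) * (r - l) powr (1 / q) *
    ((r - s) * \<bar>r - s\<bar> powr p - (l - s) * \<bar>l - s\<bar> powr p) powr (1 / p)"
  proof (rule increment_bound[OF \<open>l \<le> r\<close> _ pq, where g' = "\<lambda>t. (t - s) * (real n * x t ^ (n - 1) * (b - a))"])
    show "0 \<le> (b - a) * real n * S"
      using \<open>a < b\<close> by (simp add: S_def)
  next
    fix t assume t: "l \<le> t" "t \<le> r"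
    have x: "(x has_real_derivative b - a) (at t)"
      unfolding x_def by (auto intro!: derivative_eq_intros)
    have "(real n + 1) * ((b - a) * x t ^ n) / ((real n + 1) * (b - a)) = x t ^ n"
      using \<open>a < b\<close> by (simp add: add.commute)
    then have "((\<lambda>t. x t ^ (n + 1) / ((real n + 1) * (b - a))) has_real_derivative x t ^ n) (at t)"
      using DERIV_cdivide[OF DERIV_power[OF x, of "n + 1"], of "(real n + 1) * (b - a)"]
      by (simp del: power_Suc add: add.commute)
    moreover have "((\<lambda>t. (t - s) * x t ^ n) has_real_derivative
        x t ^ n + (t - s) * (real n * x t ^ (n - 1) * (b - a))) (at t)"
      by (rule derivative_eq_intros x refl | simp)+
    \<comment> \<open>The term \<open>x t ^ n\<close> left by the product rule cancels against the
      derivative of the quotient.\<close>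
    ultimately show "(g has_real_derivative (t - s) * (real n * x t ^ (n - 1) * (b - a))) (at t)"
      unfolding g_def using DERIV_diff by fastforce
    have "\<bar>x t\<bar> ^ (n - 1) \<le> S"
      unfolding S_def using abs_affine_le_max[of a b l t r] t assms
      by (intro abs_power_le_Sup_powr) auto
    then have "(b - a) * real n * \<bar>t - s\<bar> * \<bar>x t\<bar> ^ (n - 1) \<le> (b - a) * real n * \<bar>t - s\<bar> * S"
      using \<open>a < b\<close> by (intro mult_left_mono) auto
    then show "\<bar>(t - s) * (real n * x t ^ (n - 1) * (b - a))\<bar> \<le> (b - a) * real n * S * \<bar>t - s\<bar>"
      using \<open>a < b\<close> by (simp add: abs_mult power_abs mult_ac)
  qed
  then show ?thesis
    by (simp add: S_def mult_ac)
qed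

theorem proposition2:
  fixes a b \<alpha> lam p q :: real and n :: nat
  assumes "a < b" and "n \<ge> 2"
    and "\<alpha> \<in> {0..1}" and "lam \<in> {0..1}"
    and "q > 1" and "1 / p + 1 / q = 1"
  shows "(\<alpha> * lam \<le> 1 - \<alpha> \<and> 1 - \<alpha> \<le> 1 - lam * (1 - \<alpha>) \<longrightarrow>
      \<bar>lam * wmean \<alpha> (a ^ n) (b ^ n) + (1 - lam) * (wmean \<alpha> a b) ^ n - (log_mean n a b) ^ n\<bar>
      \<le> (b - a) * (1 / (p + 1)) powr (1 / p) * real n *
        ((1 - \<alpha>) powr (1 / q) * (F_sup n q \<alpha> a b) powr (1 / q) * (eps1 p \<alpha> lam) powr (1 / p)
         + \<alpha> powr (1 / q) * (G_sup n q \<alpha> a b) powr (1 / q) * (eps3 p \<alpha> lam) powr (1 / p)))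
    \<and> (\<alpha> * lam \<le> 1 - lam * (1 - \<alpha>) \<and> 1 - lam * (1 - \<alpha>) \<le> 1 - \<alpha> \<longrightarrow>
      \<bar>lam * wmean \<alpha> (a ^ n) (b ^ n) + (1 - lam) * (wmean \<alpha> a b) ^ n - (log_mean n a b) ^ n\<bar>
      \<le> (b - a) * (1 / (p + 1)) powr (1 / p) * real n *
        ((1 - \<alpha>) powr (1 / q) * (F_sup n q \<alpha> a b) powr (1 / q) * (eps1 p \<alpha> lam) powr (1 / p)
         + \<alpha> powr (1 / q) * (G_sup n q \<alpha> a b) powr (1 / q) * (eps4 p \<alpha> lam) powr (1 / p)))
    \<and> (1 - \<alpha> \<le> \<alpha> * lam \<and> \<alpha> * lam \<le> 1 - lam * (1 - \<alpha>) \<longrightarrow>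
      \<bar>lam * wmean \<alpha> (a ^ n) (b ^ n) + (1 - lam) * (wmean \<alpha> a b) ^ n - (log_mean n a b) ^ n\<bar>
      \<le> (b - a) * (1 / (p + 1)) powr (1 / p) * real n *
        ((1 - \<alpha>) powr (1 / q) * (F_sup n q \<alpha> a b) powr (1 / q) * (eps2 p \<alpha> lam) powr (1 / p)
         + \<alpha> powr (1 / q) * (G_sup n q \<alpha> a b) powr (1 / q) * (eps3 p \<alpha> lam) powr (1 / p)))"
proof -
  define g where "g s t = (t - s) * (t * b + (1 - t) * a) ^ n
    - (t * b + (1 - t) * a) ^ (n + 1) / ((real n + 1) * (b - a))" for s t
  define E where "E l r s = ((r - s) * \<bar>r - s\<bar> powr p - (l - s) * \<bar>l - s\<bar> powr p) powr (1 / p)"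
    for l r s
  define K where "K = (b - a) * (1 / (p + 1)) powr (1 / p) * real n"
  define s1 s2 where "s1 = \<alpha> * lam" and "s2 = 1 - lam * (1 - \<alpha>)"
  \<comment> \<open>The bound \<open>p > 1\<close> is recovered from \<open>q > 1\<close> and
    conjugacy.\<close>
  have "1 / p = 1 - 1 / q" "0 < 1 / q" "1 / q < 1"
    using assms by auto
  then have "0 < 1 / p" "1 / p < 1"
    by linarith+
  then have p: "p > 1"
    by (simp add: divide_less_eq_1 zero_less_divide_iff)
  have c: "(1 - \<alpha>) * b + (1 - (1 - \<alpha>)) * a = wmean \<alpha> a b"
    by (simp add: wmean_def)
  have 1: "\<bar>g s1 (1 - \<alpha>) - g s1 0\<bar>
      \<le> K * ((1 - \<alpha>) powr (1 / q) * F_sup n q \<alpha> a b powr (1 / q) * E 0 (1 - \<alpha>) s1)"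
    using segment_bound[of a b n 0 "1 - \<alpha>" p q s1] assms p
    unfolding g_def E_def K_def F_sup_def c by simp
  have 2: "\<bar>g s2 1 - g s2 (1 - \<alpha>)\<bar>
      \<le> K * (\<alpha> powr (1 / q) * G_sup n q \<alpha> a b powr (1 / q) * E (1 - \<alpha>) 1 s2)"
    using segment_bound[of a b n "1 - \<alpha>" 1 p q s2] assms p
    unfolding g_def E_def K_def G_sup_def c by (simp add: insert_commute)
  \<comment> \<open>The pivots are chosen for this: \<open>a ^ n\<close> gets the coefficient
    \<open>s1\<close>, \<open>b ^ n\<close> gets \<open>1 - s2\<close>, and the power of the mean
    gets \<open>s2 - s1 = 1 - lam\<close>. The quotients telescope to minus the logarithmic mean
    term.\<close>
  have sum: "lam * wmean \<alpha> (a ^ n) (b ^ n) + (1 - lam) * (wmean \<alpha> a b) ^ n - (log_mean n a b) ^ n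
      = (g s1 (1 - \<alpha>) - g s1 0) + (g s2 1 - g s2 (1 - \<alpha>))"
  proof -
    have "(log_mean n a b) ^ n = (b ^ (n + 1) - a ^ (n + 1)) / ((real n + 1) * (b - a))"
      using assms by (intro log_mean_power) auto
    then show ?thesis
      unfolding g_def c s1_def s2_def
      by (simp add: wmean_def[of _ "a ^ n"] diff_divide_distrib algebra_simps)
  qed
  have main: "\<bar>lam * wmean \<alpha> (a ^ n) (b ^ n) + (1 - lam) * (wmean \<alpha> a b) ^ n - (log_mean n a b) ^ n\<bar>
      \<le> K * ((1 - \<alpha>) powr (1 / q) * F_sup n q \<alpha> a b powr (1 / q) * E 0 (1 - \<alpha>) s1
        + \<alpha> powr (1 / q) * G_sup n q \<alpha> a b powr (1 / q) * E (1 - \<alpha>) 1 s2)"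
    unfolding sum distrib_left using 1 2 by linarith
  have pos: "y * \<bar>y\<bar> powr p = y powr (p + 1)" if "y \<ge> 0" for y :: real
    using that p by (simp add: powr_add mult.commute)
  have neg: "y * \<bar>y\<bar> powr p = - ((- y) powr (p + 1))" if "y \<le> 0" for y :: real
    using pos[of "- y"] that by simp
  \<comment> \<open>A pivot inside the interval yields \<open>eps1\<close> and \<open>eps3\<close>;
    one to its right yields \<open>eps2\<close>, one to its left \<open>eps4\<close>.\<close>
  have E_mid: "E l r s = ((s - l) powr (p + 1) + (r - s) powr (p + 1)) powr (1 / p)"
    if "l \<le> s" "s \<le> r" for l r s
    using that pos[of "r - s"] neg[of "l - s"] by (simp add: E_def add.commute)
  have E_right: "E l r s = ((s - l) powr (p + 1) - (s - r) powr (p + 1)) powr (1 / p)"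
    if "l \<le> s" "r \<le> s" for l r s
    using that neg[of "r - s"] neg[of "l - s"] by (simp add: E_def)
  have E_left: "E l r s = ((r - s) powr (p + 1) - (l - s) powr (p + 1)) powr (1 / p)"
    if "s \<le> l" "s \<le> r" for l r s
    using that pos[of "r - s"] pos[of "l - s"] by (simp add: E_def)
  have s: "0 \<le> s1" "s2 \<le> 1"
    using assms by (auto simp: s1_def s2_def)
  have eps1: "E 0 (1 - \<alpha>) s1 = eps1 p \<alpha> lam powr (1 / p)" if "\<alpha> * lam \<le> 1 - \<alpha>"
    using E_mid[of 0 s1 "1 - \<alpha>"] that s by (simp add: s1_def eps1_def)
  have eps2: "E 0 (1 - \<alpha>) s1 = eps2 p \<alpha> lam powr (1 / p)" if "1 - \<alpha> \<le> \<alpha> * lam"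
    using E_right[of 0 s1 "1 - \<alpha>"] that s by (simp add: s1_def eps2_def algebra_simps)
  have eps3: "E (1 - \<alpha>) 1 s2 = eps3 p \<alpha> lam powr (1 / p)" if "1 - \<alpha> \<le> 1 - lam * (1 - \<alpha>)"
    using E_mid[of "1 - \<alpha>" s2 1] that s by (simp add: s2_def eps3_def algebra_simps)
  have eps4: "E (1 - \<alpha>) 1 s2 = eps4 p \<alpha> lam powr (1 / p)" if "1 - lam * (1 - \<alpha>) \<le> 1 - \<alpha>"
    using E_left[of s2 "1 - \<alpha>" 1] that s by (simp add: s2_def eps4_def algebra_simps)
  \<comment> \<open>In the last two cases one of the inequalities needed for the rewriting follows
    by transitivity.\<close>
  show ?thesis
    using main unfolding K_def by (intro conjI impI; elim conjE; simp only: eps1 eps2 eps3 eps4)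
qed

end
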